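(* Let $n \geq 1$ and let $G$ be the sibling tree $ST_n$. Then the locating-domination number of $G$ is $$\gamma^{L}(G) = \begin{cases} \frac{1}{5}(2^{n+2}+1) & \text{if } n\equiv 0 \pmod 4,\\ \frac{1}{5}(2^{n+2}+2) & \text{if } n\equiv 1 \pmod 4,\\ \frac{1}{5}(2^{n+2}-1) & \text{if } n\equiv 2 \pmod 4,\\ \frac{1}{5}(2^{n+2}-2) & \text{if } n\equiv 3 \pmod 4.\end{cases}$$
   Context: The sibling tree $ST_n$ has vertex set $\{1,2,\dots,2^{n+1}-1\}$; its edges are the edges of the complete binary tree of height $n$ in which vertex $x$ has children $2x$ and $2x+1$ (root $1$ at level $0$; vertex $v$ is at level $i$ iff $2^i\le v\le 2^{i+1}-1$), together with the sibling edges $\{2x,2x+1\}$ for every $x$ with $1\le x\le 2^n-1$. A locating-dominating set of $G$ is a set $S\subseteq V(G)$ such that every vertex of $V(G)\setminus S$ is adjacent to some vertex of $S$, and for every two distinct vertices $u,v\in V(G)\setminus S$, $N(u)\cap S\neq N(v)\cap S$ (open neighborhoods). $\gamma^{L}(G)$ is the minimum cardinality of a locating-dominating set. *)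

theory Defs
  imports Complex_Main
begin

text \<open>
  A finite simple graph is given by its vertex set \<open>V\<close> and its edge set \<open>E\<close>,
  the edges being two-element subsets of \<open>V\<close>.
\<close>

definition neighborhood :: "'a set \<Rightarrow> 'a set set \<Rightarrow> 'a \<Rightarrow> 'a set" where
  "neighborhood V E v = {u \<in> V. {u, v} \<in> E}"

definition locating_dominating :: "'a set \<Rightarrow> 'a set set \<Rightarrow> 'a set \<Rightarrow> bool" where
  "locating_dominating V E S \<longleftrightarrow>
     S \<subseteq> V \<and>
     (\<forall>v \<in> V - S. \<exists>u \<in> S. {u, v} \<in> E) \<and>
     (\<forall>u \<in> V - S. \<forall>v \<in> V - S. u \<noteq> v \<longrightarrow>
        neighborhood V E u \<inter> S \<noteq> neighborhood V E v \<inter> S)"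

definition locating_domination_number :: "'a set \<Rightarrow> 'a set set \<Rightarrow> nat" where
  "locating_domination_number V E = (LEAST k. \<exists>S. locating_dominating V E S \<and> card S = k)"

definition ST_verts :: "nat \<Rightarrow> nat set" where
  "ST_verts n = {1..2 ^ (n + 1) - 1}"

definition ST_edges :: "nat \<Rightarrow> nat set set" where
  "ST_edges n =
     {{x, 2 * x} | x. 1 \<le> x \<and> x \<le> 2 ^ n - 1} \<union>
     {{x, 2 * x + 1} | x. 1 \<le> x \<and> x \<le> 2 ^ n - 1} \<union>
     {{2 * x, 2 * x + 1} | x. 1 \<le> x \<and> x \<le> 2 ^ n - 1}"

end

theory Submission
  imports Defs
begin

text \<open>
  Two vertices of the sibling tree with the same code \<open>N(v) \<inter> S\<close> of size at least two coincide,
  so only codes of size at most one matter.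

  Upper bound: counting levels from the leaves, take one vertex of every sibling pair on the levels
  \<open>0, 4, 8, \<dots>\<close> and all vertices on the levels \<open>2, 6, 10, \<dots>\<close>; adjust at the root.

  Lower bound: it suffices to show \<open>5 |S| \<ge> 2 |V|\<close>, since the construction exceeds this by at
  most \<open>4\<close>. For the subtree below \<open>v\<close>, the excess \<open>5 |S| - 2 |V|\<close> is bounded below by induction on
  its height \<open>h\<close>, the bound depending on \<open>h mod 4\<close> and on whether \<open>v \<in> S\<close>, \<open>v\<close> is not dominated from
  below, or \<open>v\<close> has from below the same code as one of its children.
\<close>

section \<open>Adjacency in the sibling tree\<close>

text \<open>Meaningful for positive arguments only: \<open>0\<close> counts as adjacent to itself.\<close>

definition adjacent :: "nat \<Rightarrow> nat \<Rightarrow> bool" where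
  "adjacent u v \<longleftrightarrow> v = 2 * u \<or> v = Suc (2 * u) \<or> u = 2 * v \<or> u = Suc (2 * v) \<or>
     even u \<and> v = Suc u \<or> even v \<and> u = Suc v"

definition code :: "nat set \<Rightarrow> nat \<Rightarrow> nat set" where
  "code S v = {w \<in> S. adjacent w v}"

text \<open>Stated for vertex sets \<open>{1..<N}\<close> with arbitrary \<open>N\<close>, so that no powers of two occur.\<close>

definition ld_set :: "nat \<Rightarrow> nat set \<Rightarrow> bool" where
  "ld_set N S \<longleftrightarrow> S \<subseteq> {1..<N} \<and> (\<forall>v \<in> {1..<N} - S. code S v \<noteq> {}) \<and>
     inj_on (code S) ({1..<N} - S)"

lemma ST_verts_eq: "ST_verts n = {1..<2 ^ (n + 1)}"
  by (auto simp: ST_verts_def)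

lemma ST_edges_iff:
  assumes "u \<in> ST_verts n" "v \<in> ST_verts n"
  shows "{u, v} \<in> ST_edges n \<longleftrightarrow> adjacent u v"
proof
  assume "{u, v} \<in> ST_edges n"
  then show "adjacent u v"
    by (auto simp: ST_edges_def adjacent_def doubleton_eq_iff)
next
  have edges: "{x, 2 * x} \<in> ST_edges n" "{x, 2 * x + 1} \<in> ST_edges n"
    "{2 * x, 2 * x + 1} \<in> ST_edges n" if "1 \<le> x" "2 * x \<in> ST_verts n" for x
  proof -
    have "x \<le> 2 ^ n - 1" using that by (simp add: ST_verts_eq)
    with that(1) show "{x, 2 * x} \<in> ST_edges n" "{x, 2 * x + 1} \<in> ST_edges n"
      "{2 * x, 2 * x + 1} \<in> ST_edges n" unfolding ST_edges_def by blast+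
  qed
  have even_vert: "2 * x \<in> ST_verts n" if "2 * x + 1 \<in> ST_verts n" "1 \<le> x" for x
    using that by (simp add: ST_verts_eq)
  have pos: "u \<ge> 1" "v \<ge> 1" using assms by (auto simp: ST_verts_eq)
  assume "adjacent u v"
  then consider "v = 2 * u" | "v = 2 * u + 1" | "u = 2 * v" | "u = 2 * v + 1"
    | "even u" "v = u + 1" | "even v" "u = v + 1"
    by (auto simp: adjacent_def)
  then show "{u, v} \<in> ST_edges n"
  proof cases
    case 5
    then obtain x where "u = 2 * x" by blast
    with 5 edges[of x] assms pos show ?thesis by simp
  next
    case 6
    then obtain x where "v = 2 * x" by blast
    with 6 edges[of x] assms pos show ?thesis by (simp add: insert_commute)
  qed (use edges even_vert assms pos in \<open>simp_all add: insert_commute\<close>)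
qed

lemma locating_dominating_ST_iff:
  "locating_dominating (ST_verts n) (ST_edges n) S \<longleftrightarrow> ld_set (2 ^ (n + 1)) S"
proof (cases "S \<subseteq> ST_verts n")
  case True
  then have nbh: "neighborhood (ST_verts n) (ST_edges n) v \<inter> S = code S v" if "v \<in> ST_verts n" for v
    using that by (auto simp: neighborhood_def code_def ST_edges_iff)
  have dom: "(\<exists>u \<in> S. {u, v} \<in> ST_edges n) \<longleftrightarrow> code S v \<noteq> {}" if "v \<in> ST_verts n" for v
    using True that by (auto simp: code_def ST_edges_iff subset_iff)
  have "locating_dominating (ST_verts n) (ST_edges n) S \<longleftrightarrow>
      (\<forall>v \<in> ST_verts n - S. code S v \<noteq> {}) \<and> inj_on (code S) (ST_verts n - S)"
    unfolding locating_dominating_def inj_on_def using True by (auto simp: nbh dom)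
  with True show ?thesis by (simp add: ld_set_def ST_verts_eq)
next
  case False
  then show ?thesis by (auto simp: ld_set_def locating_dominating_def ST_verts_eq)
qed

section \<open>The lower bound\<close>

text \<open>Parent and sibling are left out so that the condition depends on the subtree of
  \<open>v\<close> alone.\<close>

definition undominated :: "nat set \<Rightarrow> nat \<Rightarrow> bool" where
  "undominated S v \<longleftrightarrow> v \<notin> S \<and> 2 * v \<notin> S \<and> 2 * v + 1 \<notin> S"

text \<open>The undominated child sees only its sibling, which is also all that \<open>v\<close>
  sees below; only the parent or sibling of \<open>v\<close> can separate the two.\<close>

definition clashing :: "nat set \<Rightarrow> nat \<Rightarrow> bool" where
  "clashing S v \<longleftrightarrow> v \<notin> S \<and>
     (2 * v \<in> S \<and> undominated S (2 * v + 1) \<or> 2 * v + 1 \<in> S \<and> undominated S (2 * v))"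

lemma adjacent_even_iff:
  "v \<ge> 1 \<Longrightarrow> adjacent w (2 * v) \<longleftrightarrow> w \<in> {v, Suc (2 * v), 4 * v, Suc (4 * v)}"
  by (auto simp: adjacent_def) presburger+

lemma adjacent_odd_iff:
  "v \<ge> 1 \<Longrightarrow> adjacent w (Suc (2 * v)) \<longleftrightarrow>
     w \<in> {v, 2 * v, Suc (Suc (4 * v)), Suc (Suc (Suc (4 * v)))}"
  by (auto simp: adjacent_def)

lemma mod_4_cases [case_names 1 2 3 4]:
  fixes h :: nat
  obtains "h mod 4 = 0" "Suc h mod 4 = 1" | "h mod 4 = 1" "Suc h mod 4 = 2"
    | "h mod 4 = 2" "Suc h mod 4 = 3" | "h mod 4 = 3" "Suc h mod 4 = 0"
proof -
  have "h mod 4 < 4" by simp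
  then consider "h mod 4 = 0" | "h mod 4 = 1" | "h mod 4 = 2" | "h mod 4 = 3" by linarith
  then show thesis by cases (use that in \<open>simp_all add: mod_Suc\<close>)
qed

text \<open>The descendants of \<open>v\<close> at depth \<open>i\<close> form this interval, so the
  sum counts \<open>S\<close> in the subtree of height \<open>h\<close> rooted at
  \<open>v\<close>.\<close>

definition weight :: "nat set \<Rightarrow> nat \<Rightarrow> nat \<Rightarrow> nat" where
  "weight S h v = (\<Sum>i\<le>h. card (S \<inter> {2 ^ i * v..<2 ^ i * (v + 1)}))"

lemma card_Int_split:
  "a \<le> b \<Longrightarrow> b \<le> c \<Longrightarrow> card (S \<inter> {a..<c}) = card (S \<inter> {a..<b}) + card (S \<inter> {b..<c})"
  for a b c :: nat
  by (subst card_Un_disjoint[symmetric]) (auto simp: Int_Un_distrib[symmetric] ivl_disj_un)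

lemma weight_0: "weight S 0 v = (if v \<in> S then 1 else 0)"
proof -
  have "S \<inter> {v..<Suc v} = (if v \<in> S then {v} else {})" by auto
  then show ?thesis by (simp add: weight_def)
qed

lemma weight_Suc:
  "weight S (Suc h) v = (if v \<in> S then 1 else 0) + weight S h (2 * v) + weight S h (2 * v + 1)"
proof -
  have "card (S \<inter> {2 ^ Suc i * v..<2 ^ Suc i * (v + 1)}) =
      card (S \<inter> {2 ^ i * (2 * v)..<2 ^ i * (2 * v + 1)}) +
      card (S \<inter> {2 ^ i * (2 * v + 1)..<2 ^ i * (2 * v + 1 + 1)})" for i
    using card_Int_split[of "2 ^ i * (2 * v)" "2 ^ i * (2 * v + 1)" "2 ^ i * (2 * v + 2)" S]
    by (simp add: algebra_simps)
  then have "weight S (Suc h) v = weight S 0 v + (weight S h (2 * v) + weight S h (2 * v + 1))"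
    unfolding weight_def sum.atMost_Suc_shift sum.distrib[symmetric] by simp
  then show ?thesis by (simp add: weight_0)
qed

lemma weight_root: "weight S h 1 = card (S \<inter> {1..<2 ^ (h + 1)})"
proof (induction h)
  case 0
  show ?case by (simp add: weight_def numeral_2_eq_2)
next
  case (Suc h)
  have "weight S (Suc h) 1 = weight S h 1 + card (S \<inter> {2 ^ Suc h..<2 ^ (Suc h + 1)})"
    by (simp add: weight_def mult.commute)
  with Suc show ?case
    using card_Int_split[of 1 "2 ^ Suc h" "2 ^ (Suc h + 1)" S] by simp
qed

definition excess :: "nat set \<Rightarrow> nat \<Rightarrow> nat \<Rightarrow> int" where
  "excess S h v = 5 * int (weight S h v) - 2 * (2 ^ (h + 1) - 1)"

lemma excess_Suc:
  "excess S (Suc h) v = (if v \<in> S then 3 else - 2) + excess S h (2 * v) + excess S h (2 * v + 1)"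
  by (simp add: excess_def weight_Suc)

text \<open>
  The table is a fixed point of the four-periodic recursion for the minimal excess of a subtree of
  height \<open>h\<close> whose root is of the given kind.
\<close>

definition excess_bound :: "nat set \<Rightarrow> nat \<Rightarrow> nat \<Rightarrow> int" where
  "excess_bound S h v =
     (if v \<in> S then [3, 4, 1, 5]
      else if undominated S v then [- 2, 4, 6, 0]
      else if clashing S v then [3, - 1, 1, 0]
      else [3, 4, 1, 0]) ! (h mod 4)"

section \<open>Local constraints and induction over subtrees\<close>

context
  fixes N :: nat and S :: "nat set"
  assumes ld: "ld_set N S" and N_even: "even N"
begin

lemma code_inj:
  "\<lbrakk>code S u = code S v; 1 \<le> u; u < N; u \<notin> S; 1 \<le> v; v < N; v \<notin> S\<rbrakk> \<Longrightarrow> u = v"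
  using ld by (auto simp: ld_set_def inj_on_def)

lemma code_nonempty: "\<lbrakk>1 \<le> v; v < N; v \<notin> S\<rbrakk> \<Longrightarrow> code S v \<noteq> {}"
  using ld by (auto simp: ld_set_def)

text \<open>Both codes would reduce to \<open>S \<inter> {v}\<close>.\<close>

lemma not_both_children_undominated:
  assumes "1 \<le> v" "2 * v + 1 < N" "undominated S (2 * v)" "undominated S (2 * v + 1)"
  shows False
proof -
  have "code S (2 * v) = code S (2 * v + 1)"
    using assms by (auto simp: code_def adjacent_even_iff adjacent_odd_iff undominated_def)
  then show False
    using code_inj[of "2 * v" "2 * v + 1"] assms by (auto simp: undominated_def)
qed

text \<open>With parent and sibling outside \<open>S\<close>, the code of \<open>v\<close> comes
  from its children alone, so neither defect can be repaired from above.\<close>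

lemma not_undominated_nor_clashing:
  assumes v: "1 \<le> v" "v < N" "v div 2 \<notin> S" "(if even v then v + 1 else v - 1) \<notin> S"
  shows "\<not> undominated S v" "\<not> clashing S v"
proof -
  have nbh: "w = 2 * v \<or> w = 2 * v + 1" if "w \<in> S" "adjacent w v" for w
    using that v by (auto simp: adjacent_def split: if_splits)
  show "\<not> undominated S v"
  proof
    assume "undominated S v"
    then have "code S v = {}" "v \<notin> S" using nbh by (auto simp: code_def undominated_def)
    then show False using code_nonempty v by blast
  qed
  have bound: "w < N" if "w \<in> S" for w using that ld by (auto simp: ld_set_def)
  have par: "adjacent (2 * v) v" "adjacent (2 * v + 1) v" using v by (auto simp: adjacent_def)
  show "\<not> clashing S v"
  proof
    assume c: "clashing S v"
    then have vS: "v \<notin> S" by (simp add: clashing_def)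
    from c consider "2 * v \<in> S" "undominated S (2 * v + 1)" | "2 * v + 1 \<in> S" "undominated S (2 * v)"
      by (auto simp: clashing_def)
    then show False
    proof cases
      case 1
      then have "code S v = {2 * v}" using nbh par by (auto simp: code_def undominated_def)
      moreover have "code S (2 * v + 1) = {2 * v}"
        using 1 vS v by (auto simp: code_def undominated_def adjacent_odd_iff)
      \<comment> \<open>\<open>N\<close> is even, so the sibling of the vertex \<open>2 * v\<close>
        is a vertex too.\<close>
      moreover have "2 * v + 1 < N"
        using bound[OF 1(1)] N_even by presburger
      ultimately show False using code_inj[of v "2 * v + 1"] 1 vS v by (auto simp: undominated_def)
    next
      case 2
      then have "code S v = {2 * v + 1}" using nbh par by (auto simp: code_def undominated_def)
      moreover have "code S (2 * v) = {2 * v + 1}"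
        using 2 vS v by (auto simp: code_def undominated_def adjacent_even_iff)
      ultimately show False
        using code_inj[of v "2 * v"] 2 vS v bound[of "2 * v + 1"] by (auto simp: undominated_def)
    qed
  qed
qed

text \<open>The two inequalities put depth \<open>h\<close> below \<open>v\<close> inside the vertex
  range and depth \<open>h + 1\<close> outside it: the subtree of \<open>v\<close> has height
  exactly \<open>h\<close>.\<close>

lemma excess_ge:
  assumes "1 \<le> v" "2 ^ h * (v + 1) \<le> N" "N \<le> 2 ^ (h + 1) * v"
  shows "excess_bound S h v \<le> excess S h v"
  using assms
proof (induction h arbitrary: v)
  case 0
  then have "2 * v \<notin> S" "2 * v + 1 \<notin> S" using ld by (auto simp: ld_set_def)
  then show ?case by (simp add: excess_bound_def excess_def weight_0 undominated_def)
next
  case (Suc h)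
  let ?a = "2 * v" and ?b = "2 * v + 1"
  have "2 ^ h * (?a + 2) \<le> N" "N \<le> 2 ^ (h + 1) * ?a"
    using Suc.prems by (simp_all add: algebra_simps)
  then have ind: "excess_bound S h ?a \<le> excess S h ?a" "excess_bound S h ?b \<le> excess S h ?b"
    using Suc.prems(1) by (auto intro!: Suc.IH simp: algebra_simps)
  have "?a + 2 \<le> 2 ^ h * (?a + 2)" using mult_le_mono1[of 1 "2 ^ h" "?a + 2"] by simp
  also note \<open>2 ^ h * (?a + 2) \<le> N\<close>
  finally have lt: "?b < N" by simp
  have both: "\<not> (undominated S ?a \<and> undominated S ?b)"
    using not_both_children_undominated Suc.prems(1) lt by blast
  \<comment> \<open>For undominated \<open>v\<close>, each child has parent and sibling outside
    \<open>S\<close>.\<close>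
  have z: "\<not> undominated S ?a \<and> \<not> clashing S ?a \<and> \<not> undominated S ?b \<and> \<not> clashing S ?b"
    if "undominated S v"
    using that not_undominated_nor_clashing[of ?a] not_undominated_nor_clashing[of ?b] lt Suc.prems(1)
    by (auto simp: undominated_def)
  have in_S: "\<not> undominated S w \<and> \<not> clashing S w" if "w \<in> S" for w
    using that by (auto simp: undominated_def clashing_def)
  have t: "clashing S v \<longleftrightarrow> v \<notin> S \<and> (?a \<in> S \<and> undominated S ?b \<or> ?b \<in> S \<and> undominated S ?a)"
    by (simp add: clashing_def)
  have u: "undominated S v \<longleftrightarrow> v \<notin> S \<and> ?a \<notin> S \<and> ?b \<notin> S"
    by (simp add: undominated_def)
  \<comment> \<open>What remains is a finite check over the states of \<open>v\<close> and its
    children, one residue of \<open>h\<close> at a time; \<open>facts\<close> excludes the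
    incompatible states.\<close>
  have "excess_bound S (Suc h) v \<le>
      (if v \<in> S then 3 else - 2) + excess_bound S h ?a + excess_bound S h ?b"
  proof -
    have nth: "[p, q, r, s] ! 0 = p" "[p, q, r, s] ! 1 = q" "[p, q, r, s] ! 2 = r"
      "[p, q, r, s] ! 3 = s" for p q r s :: int
      by (simp_all add: numeral_2_eq_2 numeral_3_eq_3)
    note facts = both z in_S[of ?a] in_S[of ?b] t u
    show ?thesis
    proof (cases h rule: mod_4_cases)
      case 1
      show ?thesis unfolding excess_bound_def 1 if_distrib[of "\<lambda>l. l ! _"] nth
        using facts by (smt (verit))
    next
      case 2
      show ?thesis unfolding excess_bound_def 2 if_distrib[of "\<lambda>l. l ! _"] nth
        using facts by (smt (verit))
    next
      case 3
      show ?thesis unfolding excess_bound_def 3 if_distrib[of "\<lambda>l. l ! _"] nth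
        using facts by (smt (verit))
    next
      case 4
      show ?thesis unfolding excess_bound_def 4 if_distrib[of "\<lambda>l. l ! _"] nth
        using facts by (smt (verit))
    qed
  qed
  with ind show ?case by (simp add: excess_Suc)
qed

end

lemma ld_set_card_ge:
  assumes "ld_set (2 ^ (n + 1)) S"
  shows "5 * int (card S) \<ge> 2 ^ (n + 2) - 2"
proof -
  have even: "even (2 ^ (n + 1) :: nat)" by simp
  have S: "S \<subseteq> {1..<2 ^ (n + 1)}" using assms by (simp add: ld_set_def)
  then have "0 \<notin> S" by auto
  moreover have "(1::nat) < 2 ^ (n + 1)" by (rule one_less_power) auto
  \<comment> \<open>For the root, parent and sibling both compute to \<open>0\<close>, which is not
    in \<open>S\<close>. The negative table entries are thereby ruled out.\<close>
  ultimately have "\<not> undominated S 1" "\<not> clashing S 1"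
    using not_undominated_nor_clashing[OF assms even, of 1] by auto
  then have "0 \<le> excess_bound S n 1"
    by (cases n rule: mod_4_cases) (auto simp: excess_bound_def numeral_2_eq_2 numeral_3_eq_3)
  also have "\<dots> \<le> excess S n 1"
    using excess_ge[OF assms even, of 1 n] by simp
  finally show ?thesis
    unfolding excess_def weight_root Int_absorb2[OF S] by simp
qed

section \<open>The construction\<close>

text \<open>For \<open>N = 2 ^ m\<close> this appends four levels: empty, full, empty, left children
  only. As the first is empty, old codes do not change.\<close>

lemma ld_set_extend:
  assumes "ld_set N S" "N \<ge> 1"
  shows "ld_set (16 * N) (S \<union> {2 * N..<4 * N} \<union> (*) 2 ` {4 * N..<8 * N})"
proof -
  define T where "T = S \<union> {2 * N..<4 * N} \<union> (*) 2 ` {4 * N..<8 * N}"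
  have S: "S \<subseteq> {1..<N}" using assms by (simp add: ld_set_def)
  have T_iff: "w \<in> T \<longleftrightarrow> w \<in> S \<or> 2 * N \<le> w \<and> w < 4 * N \<or> even w \<and> 8 * N \<le> w \<and> w < 16 * N" for w
    unfolding T_def by (auto elim!: evenE)
  have old: "code T v = code S v" if "1 \<le> v" "v < N" for v
    using that S unfolding code_def by (auto simp: T_iff adjacent_def)
  have kinds: "v < N \<and> v \<notin> S \<or> N \<le> v \<and> v < 2 * N \<or> 4 * N \<le> v \<and> v < 8 * N \<or>
      odd v \<and> 8 * N \<le> v \<and> v < 16 * N" if "1 \<le> v" "v < 16 * N" "v \<notin> T" for v
    using that by (auto simp: T_iff)
  have L1: "2 * v \<in> code T v" "Suc (2 * v) \<in> code T v" if "N \<le> v" "v < 2 * N" for v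
    using that by (auto simp: code_def T_iff adjacent_def)
  have L3: "v div 2 \<in> code T v" "2 * v \<in> code T v" if "4 * N \<le> v" "v < 8 * N" for v
    using that by (auto simp: code_def T_iff adjacent_def)
  have L4: "v - 1 \<in> code T v" if "odd v" "8 * N \<le> v" "v < 16 * N" for v
    using that by (auto simp: code_def T_iff adjacent_def elim!: oddE)
  have nonempty: "code T v \<noteq> {}" if "1 \<le> v" "v < 16 * N" "v \<notin> T" for v
  proof -
    have "code S v \<noteq> {}" if "v < N" "v \<notin> S"
      using that assms \<open>1 \<le> v\<close> unfolding ld_set_def by simp
    then show ?thesis
      using kinds[OF that] L1(1)[of v] L3(1)[of v] L4[of v] old[OF that(1)] by blast
  qed
  have neq: "code T u \<noteq> code T v"
    if u: "1 \<le> u" "u \<notin> T" and v: "v < 16 * N" "v \<notin> T" and "u < v" for u v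
  proof
    assume eq: "code T u = code T v"
    have adj: "adjacent w u" if "w \<in> code T v" for w
      using that unfolding eq[symmetric] by (simp add: code_def)
    \<comment> \<open>In the second and third case \<open>2 * v\<close> is in the code of
      \<open>v\<close>, but its smallest neighbour is \<open>v\<close> itself, so the smaller
      \<open>u\<close> cannot see it.\<close>
    from kinds[of v] u v \<open>u < v\<close> consider "v < N" | "N \<le> v" "v < 2 * N" | "4 * N \<le> v" "v < 8 * N"
      | "odd v" "8 * N \<le> v" "v < 16 * N" by force
    then show False
    proof cases
      case 1
      then have "code S u = code S v" using old u \<open>u < v\<close> eq by auto
      moreover have "u \<in> {1..<N} - S" "v \<in> {1..<N} - S" using 1 u v \<open>u < v\<close> by (auto simp: T_iff)
      ultimately have "u = v" using assms by (meson ld_set_def inj_onD)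
      with \<open>u < v\<close> show False by simp
    next
      case 2
      then show False using adj[OF L1(1)] adj[OF L1(2)] \<open>u < v\<close> u
        by (auto simp: adjacent_def)
    next
      case 3
      then show False using adj[OF L3(1)] adj[OF L3(2)] \<open>u < v\<close> u assms(2)
        by (auto simp: adjacent_def)
    next
      case 4
      then obtain x where x: "v = Suc (2 * x)" by (auto elim: oddE)
      have "adjacent (2 * x) u" using adj[OF L4] 4 x by simp
      \<comment> \<open>The only neighbour of \<open>2 * x\<close> below \<open>v\<close> is its
        parent \<open>x\<close>, whose code also contains \<open>x div 2\<close>; that grandparent
        of \<open>v\<close> is not adjacent to \<open>v\<close>.\<close>
      then have "u = x" using u x \<open>u < v\<close> 4 by (auto simp: adjacent_def T_iff) presburger
      then have "x div 2 \<in> code T v" using L3(1)[of x] 4 x eq by simp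
      then have "adjacent (x div 2) (Suc (2 * x))" using x by (simp add: code_def)
      moreover have "x \<ge> 1" using 4 x assms(2) by linarith
      ultimately show False by (auto simp: adjacent_def)
    qed
  qed
  have "inj_on (code T) ({1..<16 * N} - T)"
    by (rule linorder_inj_onI') (use neq in auto)
  moreover have "T \<subseteq> {1..<16 * N}" using S assms(2) by (auto simp: T_def)
  ultimately show ?thesis using nonempty unfolding T_def[symmetric] ld_set_def by auto
qed

text \<open>The argument is the number of levels, so \<open>ST_n\<close> corresponds to \<open>opt_set (n + 1)\<close>.\<close>

fun opt_set :: "nat \<Rightarrow> nat set" where
  "opt_set 0 = {}"
| "opt_set (Suc 0) = {1}"
| "opt_set (Suc (Suc 0)) = {1, 2}"
| "opt_set (Suc (Suc (Suc 0))) = {1, 4, 6}"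
| "opt_set (Suc (Suc (Suc (Suc m)))) =
     opt_set m \<union> {2 * 2 ^ m..<4 * 2 ^ m} \<union> (*) 2 ` {4 * 2 ^ m..<8 * 2 ^ m}"

lemma ld_set_opt_set: "ld_set (2 ^ m) (opt_set m)"
proof (induction m rule: opt_set.induct)
  case 1
  show ?case by (simp add: ld_set_def)
next
  case 2
  have "{1..<2} = {1::nat}" by auto
  then show ?case by (simp add: ld_set_def)
next
  case 3
  have "{1..<4} - {1, 2} = {3::nat}" by auto
  then show ?case by (auto simp: ld_set_def code_def adjacent_def)
next
  case 4
  have V: "{1..<8} - {1, 4, 6} = {2, 3, 5, 7::nat}" by auto
  have "code {1, 4, 6} 2 = {1, 4}" "code {1, 4, 6} 3 = {1, 6}"
    "code {1, 4, 6} 5 = {4}" "code {1, 4, 6} 7 = {6}"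
    by (auto simp: code_def adjacent_def)
  then show ?case using V by (auto simp: ld_set_def doubleton_eq_iff)
next
  case (5 m)
  then show ?case using ld_set_extend[of "2 ^ m" "opt_set m"] by simp
qed

text \<open>Four more levels add \<open>6 * 2 ^ m\<close> elements, and
  \<open>30 * 2 ^ m = 2 ^ (m + 5) - 2 ^ (m + 1)\<close>, so the remainder is that of the base set
  for \<open>m mod 4\<close>.\<close>

lemma card_opt_set:
  "5 * int (card (opt_set m)) = 2 ^ (m + 1) + [- 2, 1, 2, - 1] ! (m mod 4)"
proof (induction m rule: opt_set.induct)
  case (5 m)
  have sub: "opt_set m \<subseteq> {1..<2 ^ m}" using ld_set_opt_set by (simp add: ld_set_def)
  then have lt: "x < 2 ^ m" if "x \<in> opt_set m" for x using that by auto
  from sub have fin: "finite (opt_set m)" by (rule finite_subset) simp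
  have "card (opt_set (Suc (Suc (Suc (Suc m))))) =
      card (opt_set m) + card {2 * 2 ^ m..<4 * 2 ^ m :: nat} + card ((*) 2 ` {4 * 2 ^ m..<8 * 2 ^ m :: nat})"
  proof -
    have "opt_set m \<inter> {2 * 2 ^ m..<4 * 2 ^ m} = {}"
      "(opt_set m \<union> {2 * 2 ^ m..<4 * 2 ^ m}) \<inter> (*) 2 ` {4 * 2 ^ m..<8 * 2 ^ m} = {}"
      by (auto dest!: lt)
    then show ?thesis using fin by (simp add: card_Un_disjoint)
  qed
  also have "\<dots> = card (opt_set m) + 6 * 2 ^ m"
    by (subst card_image) (auto simp: inj_on_def)
  finally have card: "int (card (opt_set (Suc (Suc (Suc (Suc m)))))) = int (card (opt_set m)) + 6 * 2 ^ m"
    by simp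
  have mod: "Suc (Suc (Suc (Suc m))) mod 4 = m mod 4" by presburger
  from 5 show ?case unfolding card mod by simp
qed simp_all

theorem theorem7:
  fixes n :: nat
  assumes "n \<ge> 1"
  shows "real (locating_domination_number (ST_verts n) (ST_edges n)) =
    (if n mod 4 = 0 then (2 ^ (n + 2) + 1) / 5
     else if n mod 4 = 1 then (2 ^ (n + 2) + 2) / 5
     else if n mod 4 = 2 then (2 ^ (n + 2) - 1) / 5
     else (2 ^ (n + 2) - 2) / 5)"
proof -
  define r :: int where "r = [- 2, 1, 2, - 1] ! ((n + 1) mod 4)"
  have r: "r = (if n mod 4 = 0 then 1 else if n mod 4 = 1 then 2 else if n mod 4 = 2 then - 1 else - 2)"
    by (cases n rule: mod_4_cases) (simp_all add: r_def)
  have card: "5 * int (card (opt_set (n + 1))) = 2 ^ (n + 2) + r"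
    using card_opt_set[of "n + 1"] by (simp add: r_def)
  have "locating_domination_number (ST_verts n) (ST_edges n) = card (opt_set (n + 1))"
    unfolding locating_domination_number_def locating_dominating_ST_iff
  proof (rule Least_equality)
    show "\<exists>S. ld_set (2 ^ (n + 1)) S \<and> card S = card (opt_set (n + 1))"
      using ld_set_opt_set by blast
  next
    fix k
    assume "\<exists>S. ld_set (2 ^ (n + 1)) S \<and> card S = k"
    then have "5 * int k \<ge> 2 ^ (n + 2) - 2" using ld_set_card_ge by blast
    \<comment> \<open>Hence \<open>5 * card (opt_set (n + 1))\<close> exceeds \<open>5 * k\<close>
      by at most 4, and integrality closes the gap.\<close>
    moreover have "r \<le> 2" using r by (simp split: if_splits)
    ultimately show "card (opt_set (n + 1)) \<le> k" using card by linarith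
  qed
  moreover have "5 * real (card (opt_set (n + 1))) = 2 ^ (n + 2) + real_of_int r"
    using arg_cong[OF card, of real_of_int] by simp
  ultimately show ?thesis using r by (auto simp: field_simps)
qed

end
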